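(* Let $T>0$, let $\delta_1=M\delta_2$ with $\delta_2>0$ and $M$ a positive integer, and let $\Omega=(-a,b)$ with $a,b>0$ and $\Omega_{\mathcal I}=[-a-\delta_1,-a]\cup[b,b+\delta_1]$. Let $u\in C^1(\Omega\times(0,T))\cap C(\overline{\Omega\cup\Omega_{\mathcal I}}\times[0,T])$ solve the Dirichlet initial-boundary value problem with quasinonlocal diffusion $$\frac{\partial u}{\partial t}(x,t)=\mathcal{L}^{\mathsf{qnl}}u(x,t)+f(x)\ \ (x\in\Omega,\ 0<t<T),$$ $$u(x,t)=g_d(x,t)\ \ (x\in\Omega_{\mathcal I},\ 0\le t\le T),\qquad u(x,0)=u^0_{\mathsf{qnl}}(x)\ \ (x\in\Omega).$$ Then $u$ satisfies the maximum principle: if $f(x)\le0$ for all $x\in\Omega$, then for all $x\in\Omega\cup\Omega_{\mathcal I}$ and $t\in[0,T]$, $$u(x,t)\le\max\Big\{\sup_{y\in\Omega_{\mathcal I},\,0\le s\le t}g_d(y,s),\ \sup_{y\in\Omega}u^0_{\mathsf{qnl}}(y)\Big\};$$ and if $f(x)\ge0$ for all $x\in\Omega$, then for all $x\in\Omega\cup\Omega_{\mathcal I}$ and $t\in[0,T]$, $$u(x,t)\ge\min\Big\{\inf_{y\in\Omega_{\mathcal I},\,0\le s\le t}g_d(y,s),\ \inf_{y\in\Omega}u^0_{\mathsf{qnl}}(y)\Big\}.$$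
   Context: Kernel: $\gamma:(0,\infty)\to[0,\infty)$ is measurable, $\gamma(s)=0$ for $s\ge 1$, and $\int_0^1 s^2\gamma(s)\,ds<\infty$. For $\delta>0$ set $\gamma_\delta(s)=\delta^{-3}\gamma(s/\delta)$, so $\gamma_\delta$ vanishes for $s\ge\delta$. Operator (acting in the $x$ variable, $t$ fixed): - if $x\le 0$: $\mathcal{L}^{\mathsf{qnl}}u(x)=\int_{\mathbb{R}}(u(y)-u(x))\gamma_{\delta_1}(|y-x|)\,dy$; - if $0<x<\delta_1$: $$\mathcal{L}^{\mathsf{qnl}}u(x)=\int_{x-\delta_1<y<0}(u(y)-u(x))\gamma_{\delta_1}(|y-x|)\,dy+\frac1M\sum_{j=1}^{M-1}\int_{x-\frac1j x<y<x+\frac1j x}(u(y)-u(x))\gamma_{\delta_2}(|y-x|)\,dy+\frac1M\int_{y>x-\frac1M x}(u(y)-u(x))\gamma_{\delta_2}(|y-x|)\,dy;$$ - if $x\ge\delta_1$: $\mathcal{L}^{\mathsf{qnl}}u(x)=\int_{\mathbb{R}}(u(y)-u(x))\gamma_{\delta_2}(|y-x|)\,dy$. Since the kernels vanish at distance $\ge\delta_1$, for $x\in\Omega$ only values of $u$ on $\Omega\cup\Omega_{\mathcal I}$ enter. Integrals are understood in the principal value sense at $y=x$ when not absolutely convergent; that $u$ solves the equation includes that $\mathcal{L}^{\mathsf{qnl}}u(x,t)$ exists at every $(x,t)\in\Omega\times(0,T)$. *)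

theory Defs
  imports "HOL-Analysis.Analysis"
begin

definition C1_on :: "('a::real_normed_vector \<Rightarrow> 'b::real_normed_vector) \<Rightarrow> 'a set \<Rightarrow> bool" where
  "C1_on f S \<longleftrightarrow>
     (\<exists>D :: 'a \<Rightarrow> 'a \<Rightarrow>\<^sub>L 'b.
        (\<forall>p\<in>S. (f has_derivative blinfun_apply (D p)) (at p)) \<and> continuous_on S D)"

text \<open>Principal value at the point \<open>x\<close>. If \<open>f\<close> is absolutely integrable on \<open>A\<close>, this is the
  Lebesgue integral, see \<open>pv_integral_eq_LINT\<close> below, so no case distinction is needed.\<close>

definition pv_integrable :: "(real \<Rightarrow> real) \<Rightarrow> real set \<Rightarrow> real \<Rightarrow> bool" where
  "pv_integrable f A x \<longleftrightarrow>
     (\<forall>\<epsilon>>0. set_integrable lebesgue (A - ball x \<epsilon>) f) \<and>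
     (\<exists>I. ((\<lambda>\<epsilon>. LINT y:A - ball x \<epsilon>|lebesgue. f y) \<longlongrightarrow> I) (at_right 0))"

definition pv_integral :: "(real \<Rightarrow> real) \<Rightarrow> real set \<Rightarrow> real \<Rightarrow> real" where
  "pv_integral f A x = Lim (at_right 0) (\<lambda>\<epsilon>. LINT y:A - ball x \<epsilon>|lebesgue. f y)"

lemma tendsto_LINT_minus_ball:
  fixes f :: "real \<Rightarrow> real"
  assumes f: "set_integrable lebesgue A f"
  shows "((\<lambda>\<epsilon>. LINT y:A - ball x \<epsilon>|lebesgue. f y) \<longlongrightarrow> (LINT y:A|lebesgue. f y)) (at_right 0)"
proof (rule tendsto_at_right_sequentially[where b = 1])
  fix S :: "nat \<Rightarrow> real"
  assume S: "\<And>n. 0 < S n" "S \<longlonglongrightarrow> 0"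
  let ?g = "\<lambda>y. indicat_real A y *\<^sub>R f y"
  have eq: "indicat_real (A - ball x r) y *\<^sub>R f y = indicat_real (- ball x r) y *\<^sub>R ?g y" for r y
    by (auto simp: indicator_def)
  have g: "integrable lebesgue ?g"
    using f by (simp add: set_integrable_def)
  show "(\<lambda>n. LINT y:A - ball x (S n)|lebesgue. f y) \<longlonglongrightarrow> (LINT y:A|lebesgue. f y)"
    unfolding set_lebesgue_integral_def eq
  proof (rule integral_dominated_convergence[where w = "\<lambda>y. \<bar>?g y\<bar>"])
    show "?g \<in> borel_measurable lebesgue"
      using g by (rule borel_measurable_integrable)
    then show "(\<lambda>y. indicat_real (- ball x (S n)) y *\<^sub>R ?g y) \<in> borel_measurable lebesgue" for n
      by (rule borel_measurable_scaleR[rotated]) (rule borel_measurable_indicator, auto)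
    show "integrable lebesgue (\<lambda>y. \<bar>?g y\<bar>)"
      using g by (rule integrable_abs)
    have "AE y in lebesgue. y \<noteq> x"
      by (rule AE_I[where N = "{x}"]) auto
    then show "AE y in lebesgue. (\<lambda>n. indicat_real (- ball x (S n)) y *\<^sub>R ?g y) \<longlonglongrightarrow> ?g y"
    proof eventually_elim
      case (elim y)
      then have "eventually (\<lambda>n. S n < dist x y) sequentially"
        using order_tendstoD(2)[OF S(2), of "dist x y"] by auto
      then have "eventually (\<lambda>n. indicat_real (- ball x (S n)) y *\<^sub>R ?g y = ?g y) sequentially"
        by eventually_elim (auto simp: indicator_def)
      then show ?case
        by (rule tendsto_eventually)
    qed
    show "AE y in lebesgue. norm (indicat_real (- ball x (S n)) y *\<^sub>R ?g y) \<le> \<bar>?g y\<bar>" for n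
      by (auto simp: indicator_def)
  qed
qed simp

lemma pv_integral_eq_LINT:
  fixes f :: "real \<Rightarrow> real"
  assumes f: "set_integrable lebesgue A f"
  shows "pv_integrable f A x" and "pv_integral f A x = (LINT y:A|lebesgue. f y)"
proof -
  have "set_integrable lebesgue (A - ball x r) f" for r
  proof -
    have eq: "indicat_real (A - ball x r) y *\<^sub>R f y
        = indicat_real (- ball x r) y *\<^sub>R (indicat_real A y *\<^sub>R f y)" for y
      by (auto simp: indicator_def)
    show ?thesis
      unfolding set_integrable_def eq
      by (rule integrable_mult_indicator) (use f in \<open>auto simp: set_integrable_def\<close>)
  qed
  then show "pv_integrable f A x"
    using tendsto_LINT_minus_ball[OF f] by (auto simp: pv_integrable_def)
  show "pv_integral f A x = (LINT y:A|lebesgue. f y)"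
    unfolding pv_integral_def by (intro tendsto_Lim tendsto_LINT_minus_ball f) simp
qed

text \<open>Only values on the positive half line are constrained; the value of the kernel at \<open>0\<close> never
  matters, since it is multiplied by \<open>u x - u x = 0\<close>.\<close>

definition nonlocal_kernel :: "(real \<Rightarrow> real) \<Rightarrow> bool" where
  "nonlocal_kernel \<gamma> \<longleftrightarrow>
     \<gamma> \<in> borel_measurable (lebesgue_on {0<..}) \<and>
     (\<forall>s>0. 0 \<le> \<gamma> s) \<and> (\<forall>s\<ge>1. \<gamma> s = 0) \<and>
     set_integrable lebesgue {0<..<1} (\<lambda>s. s\<^sup>2 * \<gamma> s)"

definition scaled_kernel :: "(real \<Rightarrow> real) \<Rightarrow> real \<Rightarrow> real \<Rightarrow> real" where
  "scaled_kernel \<gamma> \<delta> s = \<gamma> (s / \<delta>) / \<delta> ^ 3"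

definition diffusion_integrand ::
    "(real \<Rightarrow> real) \<Rightarrow> real \<Rightarrow> (real \<Rightarrow> real) \<Rightarrow> real \<Rightarrow> real \<Rightarrow> real" where
  "diffusion_integrand \<gamma> \<delta> u x y = (u y - u x) * scaled_kernel \<gamma> \<delta> \<bar>y - x\<bar>"

text \<open>For \<open>x \<in> \<Omega>\<close> the integrand vanishes wherever \<open>u\<close> would be evaluated outside
  \<open>\<Omega> \<union> \<Omega>\<^sub>I\<close>, so a total function \<open>u\<close> with arbitrary values there is harmless.\<close>

definition qnl ::
    "(real \<Rightarrow> real) \<Rightarrow> nat \<Rightarrow> real \<Rightarrow> real \<Rightarrow> (real \<Rightarrow> real) \<Rightarrow> real \<Rightarrow> real" where
  "qnl \<gamma> M \<delta>1 \<delta>2 u x =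
    (if x \<le> 0 then pv_integral (diffusion_integrand \<gamma> \<delta>1 u x) UNIV x
     else if x < \<delta>1 then
       pv_integral (diffusion_integrand \<gamma> \<delta>1 u x) {y. x - \<delta>1 < y \<and> y < 0} x
       + 1 / real M * (\<Sum>j = 1..M - 1. pv_integral (diffusion_integrand \<gamma> \<delta>2 u x)
           {y. x - 1 / real j * x < y \<and> y < x + 1 / real j * x} x)
       + 1 / real M * pv_integral (diffusion_integrand \<gamma> \<delta>2 u x) {y. y > x - 1 / real M * x} x
     else pv_integral (diffusion_integrand \<gamma> \<delta>2 u x) UNIV x)"

definition qnl_exists ::
    "(real \<Rightarrow> real) \<Rightarrow> nat \<Rightarrow> real \<Rightarrow> real \<Rightarrow> (real \<Rightarrow> real) \<Rightarrow> real \<Rightarrow> bool" where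
  "qnl_exists \<gamma> M \<delta>1 \<delta>2 u x \<longleftrightarrow>
    (if x \<le> 0 then pv_integrable (diffusion_integrand \<gamma> \<delta>1 u x) UNIV x
     else if x < \<delta>1 then
       pv_integrable (diffusion_integrand \<gamma> \<delta>1 u x) {y. x - \<delta>1 < y \<and> y < 0} x
       \<and> (\<forall>j\<in>{1..M - 1}. pv_integrable (diffusion_integrand \<gamma> \<delta>2 u x)
           {y. x - 1 / real j * x < y \<and> y < x + 1 / real j * x} x)
       \<and> pv_integrable (diffusion_integrand \<gamma> \<delta>2 u x) {y. y > x - 1 / real M * x} x
     else pv_integrable (diffusion_integrand \<gamma> \<delta>2 u x) UNIV x)"

end

theory Submission
  imports Defs
begin

text \<open>At a spatial maximum of \<open>u(\<cdot>, t)\<close> all the integrands of the operator are nonpositive, so the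
  operator is nonpositive there. The rest is the weak parabolic maximum principle, obtained by
  perturbing \<open>u\<close> to \<open>u - \<epsilon> t\<close>; it is run up to times \<open>t < T\<close>, and \<open>t = T\<close> follows by continuity,
  since the equation is not assumed at time \<open>T\<close>.\<close>

text \<open>The spatial operator enters only through \<open>max_deriv\<close>: at a maximum of
  \<open>w\<close> over \<open>K\<close> at a fixed time strictly between 0 and \<open>T\<close>,
  the time derivative is nonpositive. The lateral bound is asked only up to the target time
  \<open>t\<close>, which is what permits a supremum over times up to \<open>t\<close> later
  on.\<close>

lemma weak_parabolic_maximum_principle:
  fixes w :: "'a::topological_space \<Rightarrow> real \<Rightarrow> real"
  assumes K: "compact K"
    and cont: "continuous_on (K \<times> {0..T}) (\<lambda>(x, t). w x t)"
    and bdry: "\<And>x s. x \<in> K - \<Omega> \<Longrightarrow> 0 \<le> s \<Longrightarrow> s \<le> t \<Longrightarrow> w x s \<le> C"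
    and init: "\<And>x. x \<in> K \<Longrightarrow> w x 0 \<le> C"
    and max_deriv: "\<And>x s. x \<in> \<Omega> \<Longrightarrow> 0 < s \<Longrightarrow> s < T \<Longrightarrow> (\<And>y. y \<in> K \<Longrightarrow> w y s \<le> w x s) \<Longrightarrow>
      \<exists>D\<le>0. (w x has_real_derivative D) (at s)"
    and x: "x \<in> K" and t: "0 \<le> t" "t \<le> T"
  shows "w x t \<le> C"
proof -
  have less: "w x r \<le> C" if r: "0 \<le> r" "r \<le> t" "r < T" for r
  proof (rule ccontr)
    assume "\<not> w x r \<le> C"
    then have gt: "w x r > C" by simp
    \<comment> \<open>Chosen so that the perturbed value at \<open>(x, r)\<close> still exceeds
      \<open>C\<close>. The denominator \<open>r + 1\<close> rather than \<open>r\<close> makes the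
      inequality strict and covers \<open>r = 0\<close>.\<close>
    define \<epsilon> where "\<epsilon> = (w x r - C) / (r + 1)"
    have \<epsilon>: "\<epsilon> > 0" "\<epsilon> * r < w x r - C"
      using gt r by (auto simp: \<epsilon>_def field_simps)
    let ?v = "\<lambda>p. w (fst p) (snd p) - \<epsilon> * snd p"
    have "continuous_on (K \<times> {0..r}) (\<lambda>(x, t). w x t)"
      by (rule continuous_on_subset[OF cont]) (use r in auto)
    then have "continuous_on (K \<times> {0..r}) (\<lambda>p. w (fst p) (snd p))"
      by (simp add: case_prod_unfold)
    then have "continuous_on (K \<times> {0..r}) ?v"
      by (intro continuous_intros)
    moreover have "compact (K \<times> {0..r})" "K \<times> {0..r} \<noteq> {}"
      using K x r by (auto intro: compact_Times)
    ultimately obtain p where p: "p \<in> K \<times> {0..r}" "\<And>q. q \<in> K \<times> {0..r} \<Longrightarrow> ?v q \<le> ?v p"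
      using continuous_attains_sup[of "K \<times> {0..r}" ?v] by blast
    obtain y s where ys: "p = (y, s)" by fastforce
    have y: "y \<in> K" and s: "0 \<le> s" "s \<le> r"
      using p(1) ys by auto
    have mx: "w z q - \<epsilon> * q \<le> w y s - \<epsilon> * s" if "z \<in> K" "0 \<le> q" "q \<le> r" for z q
      using p(2)[of "(z, q)"] that ys by auto
    have "0 \<le> \<epsilon> * s" using \<epsilon>(1) s(1) by simp
    \<comment> \<open>The maximum of the perturbed function lies above its value at
      \<open>(x, r)\<close>, hence above \<open>C\<close>, and adding back the nonnegative term
      keeps it there. This excludes both the initial time and the lateral boundary for
      \<open>(y, s)\<close>.\<close>
    then have big: "w y s > C"
      using mx[OF x r(1) order_refl] \<epsilon>(2) by linarith
    have "s \<noteq> 0" using init[OF y] big by auto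
    with s have spos: "0 < s" by simp
    have "y \<in> \<Omega>" using bdry[of y s] y s r big by fastforce
    moreover have "w z s \<le> w y s" if "z \<in> K" for z
      using mx[of z s] that s by simp
    moreover have "s < T" using s r by simp
    ultimately obtain D where D: "D \<le> 0" "(w y has_real_derivative D) (at s)"
      using max_deriv[of y s] spos by blast
    have "((\<lambda>q. w y q - \<epsilon> * q) has_real_derivative D - \<epsilon>) (at s)"
      by (auto intro!: derivative_eq_intros D(2))
    \<comment> \<open>The perturbation turns \<open>D \<le> 0\<close> into a strictly negative
      derivative, so slightly earlier values are larger. Looking only backwards in time also handles
      a maximum at the final time \<open>s = r\<close>.\<close>
    from DERIV_neg_dec_left[OF this] D(1) \<epsilon>(1) obtain d where
      d: "d > 0" "\<And>h. 0 < h \<Longrightarrow> h < d \<Longrightarrow> w y s - \<epsilon> * s < w y (s - h) - \<epsilon> * (s - h)"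
      by auto
    \<comment> \<open>The cap at \<open>s\<close> keeps the earlier time \<open>s - h\<close> inside
      \<open>{0..r}\<close>, where maximality applies.\<close>
    define h where "h = min (d / 2) s"
    have "0 < h" "h < d" "h \<le> s"
      using d(1) spos by (auto simp: h_def)
    then show False
      using d(2)[of h] mx[of y "s - h"] s y by simp
  qed
  show ?thesis
  proof (cases "t < T")
    case True
    then show ?thesis using less t by simp
  next
    case False
    with t have [simp]: "t = T" by simp
    show ?thesis
    \<comment> \<open>For \<open>T = 0\<close> the interval \<open>{0..<T}\<close> is empty and its
      closure misses \<open>T\<close>, so the initial bound has to serve there.\<close>
    proof (cases "T = 0")
      case True
      then show ?thesis using init[OF x] by simp
    next
      case False
      with t have T: "0 < T" by simp
      have "continuous_on {0..T} (\<lambda>s. (\<lambda>(x, t). w x t) (x, s))"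
        by (rule continuous_on_compose2[OF cont]) (use x in \<open>auto intro!: continuous_intros\<close>)
      then have "continuous_on (closure {0..<T}) (w x)"
        using T by simp
      then show ?thesis
        by (rule continuous_le_on_closure) (use less T in auto)
    qed
  qed
qed

text \<open>The truncated integrals are nonpositive, and the sign passes to the limit. Existence is
  assumed because \<open>Lim\<close> has an unspecified value when the limit does not exist.\<close>

lemma pv_integral_nonpos:
  assumes "pv_integrable f A x" and "\<And>y. f y \<le> 0"
  shows "pv_integral f A x \<le> 0"
proof -
  from assms(1) obtain I
    where I: "((\<lambda>\<epsilon>. LINT y:A - ball x \<epsilon>|lebesgue. f y) \<longlongrightarrow> I) (at_right 0)"
    by (auto simp: pv_integrable_def)
  \<comment> \<open>Valid for every \<open>B\<close>: the integral of a nonintegrable function is 0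
    by convention.\<close>
  have "0 \<le> (LINT y:B|lebesgue. - f y)" for B
    unfolding set_lebesgue_integral_def
    by (rule Bochner_Integration.integral_nonneg) (simp add: assms(2) indicator_def)
  then have "(LINT y:B|lebesgue. f y) \<le> 0" for B
    by (simp add: set_lebesgue_integral_def)
  then have "I \<le> 0"
    by (intro tendsto_upperbound[OF I]) auto
  then show ?thesis
    using tendsto_Lim[OF _ I] by (simp add: pv_integral_def)
qed

text \<open>Serves to derive the minimum principle from the maximum principle applied to
  \<open>-u\<close>. Existence matters here too, since unspecified values of \<open>Lim\<close> need
  not respect negation.\<close>

lemma pv_uminus:
  assumes "pv_integrable f A x"
  shows pv_integrable_uminus: "pv_integrable (\<lambda>y. - f y) A x"
    and pv_integral_uminus: "pv_integral (\<lambda>y. - f y) A x = - pv_integral f A x"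
proof -
  from assms obtain I
    where I: "((\<lambda>\<epsilon>. LINT y:A - ball x \<epsilon>|lebesgue. f y) \<longlongrightarrow> I) (at_right 0)"
      and int: "\<And>\<epsilon>. \<epsilon> > 0 \<Longrightarrow> set_integrable lebesgue (A - ball x \<epsilon>) f"
    by (auto simp: pv_integrable_def)
  have "(LINT y:B|lebesgue. - f y) = - (LINT y:B|lebesgue. f y)" for B
    by (simp add: set_lebesgue_integral_def)
  with tendsto_minus[OF I] have J: "((\<lambda>\<epsilon>. LINT y:A - ball x \<epsilon>|lebesgue. - f y) \<longlongrightarrow> - I) (at_right 0)"
    by (simp only:)
  have "set_integrable lebesgue (A - ball x \<epsilon>) (\<lambda>y. - f y)" if "\<epsilon> > 0" for \<epsilon>
    using int[OF that] by (simp add: set_integrable_def)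
  with J show "pv_integrable (\<lambda>y. - f y) A x"
    by (auto simp: pv_integrable_def)
  show "pv_integral (\<lambda>y. - f y) A x = - pv_integral f A x"
    using tendsto_Lim[OF _ I] tendsto_Lim[OF _ J] by (simp add: pv_integral_def)
qed

lemma diffusion_integrand_uminus:
  "diffusion_integrand \<gamma> \<delta> (\<lambda>y. - u y) x = (\<lambda>y. - diffusion_integrand \<gamma> \<delta> u x y)"
  by (simp add: diffusion_integrand_def fun_eq_iff algebra_simps)

lemma qnl_uminus:
  assumes "qnl_exists \<gamma> M \<delta>1 \<delta>2 u x"
  shows qnl_exists_uminus: "qnl_exists \<gamma> M \<delta>1 \<delta>2 (\<lambda>y. - u y) x"
    and qnl_uminus_eq: "qnl \<gamma> M \<delta>1 \<delta>2 (\<lambda>y. - u y) x = - qnl \<gamma> M \<delta>1 \<delta>2 u x"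
  using assms
  by (auto simp: qnl_exists_def qnl_def diffusion_integrand_uminus pv_integrable_uminus
      pv_integral_uminus sum_negf split: if_splits)

text \<open>Within distance \<open>\<delta>\<close> the kernel is nonnegative and the increment of
  \<open>u\<close> nonpositive; beyond it the kernel vanishes, so maximality is required only on the
  interaction range. At \<open>y = x\<close> the kernel is evaluated at 0, where its sign is
  unconstrained, but the increment is 0.\<close>

lemma diffusion_integrand_nonpos:
  assumes "nonlocal_kernel \<gamma>" and "\<delta> > 0" and "\<And>y. \<bar>y - x\<bar> < \<delta> \<Longrightarrow> u y \<le> u x"
  shows "diffusion_integrand \<gamma> \<delta> u x y \<le> 0"
proof -
  consider "y = x" | "y \<noteq> x" "\<bar>y - x\<bar> < \<delta>" | "\<bar>y - x\<bar> \<ge> \<delta>" by linarith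
  then show ?thesis
  proof cases
    case 2
    then have "\<gamma> (\<bar>y - x\<bar> / \<delta>) \<ge> 0"
      using assms(1,2) by (auto simp: nonlocal_kernel_def)
    with 2 show ?thesis
      using assms(2) assms(3)[of y]
      by (auto simp: diffusion_integrand_def scaled_kernel_def intro!: mult_nonpos_nonneg divide_nonpos_nonneg)
  next
    case 3
    then have "\<gamma> (\<bar>y - x\<bar> / \<delta>) = 0"
      using assms(1,2) by (auto simp: nonlocal_kernel_def)
    then show ?thesis
      by (simp add: diffusion_integrand_def scaled_kernel_def)
  qed (simp add: diffusion_integrand_def)
qed

text \<open>Each branch combines principal values of pointwise nonpositive integrands with
  nonnegative weights. Because \<open>\<delta>2 \<le> \<delta>1\<close>, maximality within
  \<open>\<delta>1\<close> serves both kernels.\<close>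

lemma qnl_nonpos_at_max:
  assumes ker: "nonlocal_kernel \<gamma>" and \<delta>: "0 < \<delta>2" "\<delta>2 \<le> \<delta>1"
    and ex: "qnl_exists \<gamma> M \<delta>1 \<delta>2 u x"
    and mx: "\<And>y. \<bar>y - x\<bar> < \<delta>1 \<Longrightarrow> u y \<le> u x"
  shows "qnl \<gamma> M \<delta>1 \<delta>2 u x \<le> 0"
proof -
  have "diffusion_integrand \<gamma> \<delta>1 u x y \<le> 0" "diffusion_integrand \<gamma> \<delta>2 u x y \<le> 0" for y
    using \<delta> mx by (auto intro!: diffusion_integrand_nonpos[OF ker])
  note pv = pv_integral_nonpos[OF _ this(1)] pv_integral_nonpos[OF _ this(2)]
  show ?thesis
    using ex unfolding qnl_exists_def qnl_def
    by (auto intro!: pv add_nonpos_nonpos divide_nonpos_nonneg sum_nonpos split: if_splits)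
qed

text \<open>Stated with an arbitrary bound \<open>C\<close> in place of suprema, so that it applies
  both to \<open>u\<close> and, with negated infima, to \<open>-u\<close>.\<close>

lemma qnl_maximum_principle:
  fixes u :: "real \<Rightarrow> real \<Rightarrow> real"
  assumes ker: "nonlocal_kernel \<gamma>" and \<delta>: "0 < \<delta>2" "\<delta>2 \<le> \<delta>1"
    and cont: "continuous_on ({-a - \<delta>1..b + \<delta>1} \<times> {0..T}) (\<lambda>(x, t). u x t)"
    and ex: "\<And>x t. -a < x \<Longrightarrow> x < b \<Longrightarrow> 0 < t \<Longrightarrow> t < T \<Longrightarrow> qnl_exists \<gamma> M \<delta>1 \<delta>2 (\<lambda>y. u y t) x"
    and eq: "\<And>x t. -a < x \<Longrightarrow> x < b \<Longrightarrow> 0 < t \<Longrightarrow> t < T \<Longrightarrow>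
      (u x has_real_derivative qnl \<gamma> M \<delta>1 \<delta>2 (\<lambda>y. u y t) x + f x) (at t)"
    and f: "\<And>x. -a < x \<Longrightarrow> x < b \<Longrightarrow> f x \<le> 0"
    and bdry: "\<And>x s. x \<in> {-a - \<delta>1..b + \<delta>1} - {-a<..<b} \<Longrightarrow> 0 \<le> s \<Longrightarrow> s \<le> t \<Longrightarrow> u x s \<le> C"
    and init: "\<And>x. -a < x \<Longrightarrow> x < b \<Longrightarrow> u x 0 \<le> C"
    and x: "x \<in> {-a - \<delta>1..b + \<delta>1}" and t: "0 \<le> t" "t \<le> T"
  shows "u x t \<le> C"
proof (rule weak_parabolic_maximum_principle[where \<Omega> = "{-a<..<b}", OF compact_Icc cont bdry _ _ x t])
  show "u x 0 \<le> C" if "x \<in> {-a - \<delta>1..b + \<delta>1}" for x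
    using bdry[of x 0] init[of x] that t by (cases "x \<in> {-a<..<b}") auto
  show "\<exists>D\<le>0. (u x has_real_derivative D) (at s)"
    if x: "x \<in> {-a<..<b}" and s: "0 < s" "s < T"
      and mx: "\<And>y. y \<in> {-a - \<delta>1..b + \<delta>1} \<Longrightarrow> u y s \<le> u x s" for x s
  proof (intro exI conjI)
    show "(u x has_real_derivative qnl \<gamma> M \<delta>1 \<delta>2 (\<lambda>y. u y s) x + f x) (at s)"
      using x s by (intro eq) auto
    have "qnl \<gamma> M \<delta>1 \<delta>2 (\<lambda>y. u y s) x \<le> 0"
    proof (rule qnl_nonpos_at_max[OF ker \<delta> ex])
      \<comment> \<open>The collar has width \<open>\<delta>1\<close>, so every such
        \<open>y\<close> stays in the compact interval over which \<open>x\<close> is a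
        maximum.\<close>
      show "u y s \<le> u x s" if "\<bar>y - x\<bar> < \<delta>1" for y
        using that x by (intro mx) auto
    qed (use x s in auto)
    then show "qnl \<gamma> M \<delta>1 \<delta>2 (\<lambda>y. u y s) x + f x \<le> 0"
      using f[of x] x by auto
  qed
qed

theorem proposition3p3:
  fixes \<gamma> f :: "real \<Rightarrow> real" and u g\<^sub>d :: "real \<Rightarrow> real \<Rightarrow> real" and u\<^sub>0 :: "real \<Rightarrow> real"
    and T a b \<delta>1 \<delta>2 :: real and M :: nat and \<Omega> \<Omega>\<^sub>I :: "real set"
  assumes "nonlocal_kernel \<gamma>"
    and "T > 0" and "\<delta>2 > 0" and "M > 0" and "\<delta>1 = real M * \<delta>2"
    and "a > 0" and "b > 0"
    and "\<Omega> = {-a<..<b}" and "\<Omega>\<^sub>I = {-a - \<delta>1..-a} \<union> {b..b + \<delta>1}"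
    and "C1_on (\<lambda>(x, t). u x t) (\<Omega> \<times> {0<..<T})"
    and "continuous_on (closure (\<Omega> \<union> \<Omega>\<^sub>I) \<times> {0..T}) (\<lambda>(x, t). u x t)"
    and "\<And>x t. x \<in> \<Omega> \<Longrightarrow> 0 < t \<Longrightarrow> t < T \<Longrightarrow> qnl_exists \<gamma> M \<delta>1 \<delta>2 (\<lambda>y. u y t) x"
    and "\<And>x t. x \<in> \<Omega> \<Longrightarrow> 0 < t \<Longrightarrow> t < T \<Longrightarrow>
      ((\<lambda>s. u x s) has_real_derivative qnl \<gamma> M \<delta>1 \<delta>2 (\<lambda>y. u y t) x + f x) (at t)"
    and "\<And>x t. x \<in> \<Omega>\<^sub>I \<Longrightarrow> 0 \<le> t \<Longrightarrow> t \<le> T \<Longrightarrow> u x t = g\<^sub>d x t"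
    and "\<And>x. x \<in> \<Omega> \<Longrightarrow> u x 0 = u\<^sub>0 x"
  shows "((\<forall>x\<in>\<Omega>. f x \<le> 0) \<longrightarrow>
      (\<forall>x\<in>\<Omega> \<union> \<Omega>\<^sub>I. \<forall>t\<in>{0..T}.
        u x t \<le> max (SUP (y, s)\<in>\<Omega>\<^sub>I \<times> {0..t}. g\<^sub>d y s) (SUP y\<in>\<Omega>. u\<^sub>0 y))) \<and>
    ((\<forall>x\<in>\<Omega>. f x \<ge> 0) \<longrightarrow>
      (\<forall>x\<in>\<Omega> \<union> \<Omega>\<^sub>I. \<forall>t\<in>{0..T}.
        u x t \<ge> min (INF (y, s)\<in>\<Omega>\<^sub>I \<times> {0..t}. g\<^sub>d y s) (INF y\<in>\<Omega>. u\<^sub>0 y)))"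
proof -
  note ker = assms(1) and \<Omega> = assms(8) and \<Omega>\<^sub>I = assms(9) and ex = assms(12)
    and eq = assms(13) and bdry = assms(14) and init = assms(15)
  let ?K = "{-a - \<delta>1..b + \<delta>1}"
  have "real M \<ge> 1" using assms(4) by simp
  then have \<delta>: "0 < \<delta>2" "\<delta>2 \<le> \<delta>1"
    using assms(3,5) by auto
  have K: "\<Omega> \<union> \<Omega>\<^sub>I = ?K"
    using \<delta> assms(6,7) by (auto simp: \<Omega> \<Omega>\<^sub>I)
  have cont: "continuous_on (?K \<times> {0..T}) (\<lambda>(x, t). u x t)"
    using assms(11) by (simp add: K)
  \<comment> \<open>Real \<open>SUP\<close> and \<open>INF\<close> dominate their members only for
    bounded families. Compactness bounds \<open>u\<close>, and the data inherit the bound because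
    they are values of \<open>u\<close>.\<close>
  have "bounded ((\<lambda>(x, t). u x t) ` (?K \<times> {0..T}))"
    by (intro compact_imp_bounded compact_continuous_image cont compact_Times compact_Icc)
  then obtain B where B: "\<And>x t. x \<in> ?K \<Longrightarrow> t \<in> {0..T} \<Longrightarrow> \<bar>u x t\<bar> \<le> B"
    by (force simp: bounded_iff)
  have B_g: "\<bar>g\<^sub>d y s\<bar> \<le> B" if "y \<in> \<Omega>\<^sub>I" "0 \<le> s" "s \<le> T" for y s
  proof -
    have "y \<in> ?K" using that(1) by (simp flip: K)
    then show ?thesis using B[of y s] bdry[of y s] that by simp
  qed
  have B_0: "\<bar>u\<^sub>0 y\<bar> \<le> B" if "y \<in> \<Omega>" for y
  proof -
    have "y \<in> ?K" using that(1) by (simp flip: K)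
    then show ?thesis using B[of y 0] init[of y] that assms(2) by simp
  qed
  have upper: "u x t \<le> max (SUP (y, s)\<in>\<Omega>\<^sub>I \<times> {0..t}. g\<^sub>d y s) (SUP y\<in>\<Omega>. u\<^sub>0 y)" (is "_ \<le> ?C")
    if f: "\<forall>x\<in>\<Omega>. f x \<le> 0" and x: "x \<in> ?K" and t: "0 \<le> t" "t \<le> T" for x t
  proof (rule qnl_maximum_principle[OF ker \<delta> cont, where f = f])
    show "u x s \<le> ?C" if "x \<in> ?K - {-a<..<b}" "0 \<le> s" "s \<le> t" for x s
    proof -
      have I: "x \<in> \<Omega>\<^sub>I" using that K \<Omega> by auto
      have "bdd_above ((\<lambda>(y, s). g\<^sub>d y s) ` (\<Omega>\<^sub>I \<times> {0..t}))"
        by (rule bdd_aboveI[of _ B]) (use B_g t in \<open>fastforce simp: abs_le_iff\<close>)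
      then have "g\<^sub>d x s \<le> (SUP (y, s)\<in>\<Omega>\<^sub>I \<times> {0..t}. g\<^sub>d y s)"
        using cSUP_upper[of "(x, s)" "\<Omega>\<^sub>I \<times> {0..t}" "\<lambda>(y, s). g\<^sub>d y s"] I that by auto
      then show ?thesis using bdry[OF I] that t by simp
    qed
    show "u x 0 \<le> ?C" if "-a < x" "x < b" for x
    proof -
      have "bdd_above (u\<^sub>0 ` \<Omega>)"
        by (rule bdd_aboveI[of _ B]) (use B_0 in \<open>fastforce simp: abs_le_iff\<close>)
      then have "u\<^sub>0 x \<le> (SUP y\<in>\<Omega>. u\<^sub>0 y)"
        using that \<Omega> by (intro cSUP_upper) auto
      then show ?thesis using init[of x] that \<Omega> by auto
    qed
  qed (use f x t ex eq \<Omega> in auto)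
  have lower: "min (INF (y, s)\<in>\<Omega>\<^sub>I \<times> {0..t}. g\<^sub>d y s) (INF y\<in>\<Omega>. u\<^sub>0 y) \<le> u x t" (is "?c \<le> _")
    if f: "\<forall>x\<in>\<Omega>. f x \<ge> 0" and x: "x \<in> ?K" and t: "0 \<le> t" "t \<le> T" for x t
  proof -
    \<comment> \<open>\<open>-u\<close> solves the same problem with source
      \<open>-f \<le> 0\<close>, and an infimum of the data bounds \<open>-u\<close> from above
      after negation.\<close>
    have "- u x t \<le> - ?c"
    proof (rule qnl_maximum_principle[OF ker \<delta>, where f = "\<lambda>x. - f x" and u = "\<lambda>x t. - u x t"])
      show "continuous_on (?K \<times> {0..T}) (\<lambda>(x, t). - u x t)"
        using continuous_on_minus[OF cont] by (simp add: case_prod_unfold)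
      show "qnl_exists \<gamma> M \<delta>1 \<delta>2 (\<lambda>y. - u y t) x"
        if "-a < x" "x < b" "0 < t" "t < T" for x t
        using that \<Omega> by (intro qnl_exists_uminus ex) auto
      show "((\<lambda>t. - u x t) has_real_derivative qnl \<gamma> M \<delta>1 \<delta>2 (\<lambda>y. - u y t) x + - f x) (at t)"
        if "-a < x" "x < b" "0 < t" "t < T" for x t
        using DERIV_minus[OF eq[of x t]] qnl_uminus_eq[OF ex[of x t]] that \<Omega> by simp
      show "- u x s \<le> - ?c" if "x \<in> ?K - {-a<..<b}" "0 \<le> s" "s \<le> t" for x s
      proof -
        have I: "x \<in> \<Omega>\<^sub>I" using that K \<Omega> by auto
        have "bdd_below ((\<lambda>(y, s). g\<^sub>d y s) ` (\<Omega>\<^sub>I \<times> {0..t}))"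
          by (rule bdd_belowI[of _ "- B"]) (use B_g t in \<open>fastforce simp: abs_le_iff\<close>)
        then have "(INF (y, s)\<in>\<Omega>\<^sub>I \<times> {0..t}. g\<^sub>d y s) \<le> g\<^sub>d x s"
          using cINF_lower[of "\<lambda>(y, s). g\<^sub>d y s" "\<Omega>\<^sub>I \<times> {0..t}" "(x, s)"] I that by auto
        then show ?thesis using bdry[OF I] that t by simp
      qed
      show "- u x 0 \<le> - ?c" if "-a < x" "x < b" for x
      proof -
        have "bdd_below (u\<^sub>0 ` \<Omega>)"
          by (rule bdd_belowI[of _ "- B"]) (use B_0 in \<open>fastforce simp: abs_le_iff\<close>)
        then have "(INF y\<in>\<Omega>. u\<^sub>0 y) \<le> u\<^sub>0 x"
          using that \<Omega> by (intro cINF_lower) auto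
        then show ?thesis using init[of x] that \<Omega> by auto
      qed
    qed (use f x t \<Omega> in auto)
    then show ?thesis by simp
  qed
  show ?thesis
    using upper lower K by auto
qed

end
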